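(* Let $G=(V\cup\mathcal{H},D)$ be a factor analysis graph and suppose that ZUTA is satisfied. If there is a ZUTA-compliant, valid collection $\mathcal{A}=(A_h)_{h\in\mathcal{H}}$ that has maximal sum of cardinalities $\sum_{h\in\mathcal{H}}|A_h|$ among all valid collections (which are not necessarily ZUTA-compliant), then $$\dim(F(G))=|V|+\sum_{h\in\mathcal{H}}|A_h|.$$
   Context: A factor analysis graph is a directed graph $G=(V\cup\mathcal{H},D)$ where $V$ (observed nodes) and $\mathcal{H}$ (latent nodes) are finite disjoint sets and $D\subseteq\mathcal{H}\times V$; an element $(h,v)\in D$ is an edge $h\to v$. Write $\mathrm{pa}(v)=\{h\in\mathcal{H}: (h,v)\in D\}$ for $v\in V$ and $\mathrm{ch}(h)=\{v\in V:(h,v)\in D\}$ for $h\in\mathcal{H}$. Let $p=|V|$ and $m=|\mathcal{H}|$. Let $\mathbb{R}^D$ be the set of real $|V|\times|\mathcal{H}|$ matrices $\Lambda=(\lambda_{vh})$ with $\lambda_{vh}=0$ whenever $(h,v)\notin D$, let $\mathbb{R}^p_{>0}$ be the set of diagonal $p\times p$ matrices with positive diagonal entries, and let $\mathrm{PD}(p)$ be the cone of positive definite symmetric $p\times p$ matrices. The factor analysis model $F(G)$ is the image of the map $\tau_G:\mathbb{R}^p_{>0}\times\mathbb{R}^D\to\mathrm{PD}(p)$, $(\Omega,\Lambda)\mapsto\Omega+\Lambda\Lambda^\top$. Its dimension $\dim(F(G))$ is the maximal rank of the Jacobian matrix of $\tau_G$ (as a map into the $\binom{p+1}{2}$-dimensional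 space of symmetric matrices). Let $C(V,2)$ be the set of all two-element subsets $\{u,v\}$ of $V$ (the $2$-pairs). For $h\in\mathcal{H}$ let $C(V,2)_h=\{\{u,v\}\in C(V,2): h\in\mathrm{pa}(u)\cap\mathrm{pa}(v)\}$. A collection $\mathcal{A}=(A_h)_{h\in\mathcal{H}}$ with $A_h\subseteq C(V,2)$ is valid if (i) $A_h\subseteq C(V,2)_h$ and $|A_h|\le|\mathrm{ch}(h)|$ for all $h\in\mathcal{H}$, and (ii) $A_h\cap A_\ell=\emptyset$ for all $h\neq\ell$. ZUTA (Zero Upper Triangular Assumption): there is a labeling $\mathcal{H}=\{h_1,\dots,h_m\}$ of the latent nodes such that $\mathrm{ch}(h_i)\not\subseteq\bigcup_{j>i}\mathrm{ch}(h_j)$ for all $i=1,\dots,m$. In this case there is a labeling $V=\{v_1,\dots,v_p\}$ of the observed nodes with $v_i\in\mathrm{ch}(h_i)$ and $v_i\notin\bigcup_{j>i}\mathrm{ch}(h_j)$ for all $i=1,\dots,m$. When ZUTA is satisfied, such labelings of $\mathcal{H}$ and $V$ are fixed, and a valid collection $\mathcal{A}$ is called ZUTA-compliant (with respect to these labelings) if $\{v_i,w\}\in A_{h_i}$ for all $w\in\mathrm{ch}(h_i)\setminus\{v_i\}$ and all $i\in\{1,\dots,m\}$. *)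

theory Defs
  imports "HOL-Analysis.Analysis"
begin

(* The nodes are drawn from a finite type 'n, with V and H arbitrary (possibly empty) subsets of it.
   Every |V| x |H| or |V| x |V| matrix is represented as a matrix indexed by the whole of 'n that is
   zero outside the relevant block; this changes neither products nor ranks. *)

definition factor_analysis_graph :: "'n set \<Rightarrow> 'n set \<Rightarrow> ('n \<times> 'n) set \<Rightarrow> bool" where
  "factor_analysis_graph V H D \<longleftrightarrow> finite V \<and> finite H \<and> V \<inter> H = {} \<and> D \<subseteq> H \<times> V"

definition pa :: "'n set \<Rightarrow> ('n \<times> 'n) set \<Rightarrow> 'n \<Rightarrow> 'n set" where
  "pa H D v = {h \<in> H. (h, v) \<in> D}"

definition ch :: "'n set \<Rightarrow> ('n \<times> 'n) set \<Rightarrow> 'n \<Rightarrow> 'n set" where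
  "ch V D h = {v \<in> V. (h, v) \<in> D}"

definition positive_diagonal :: "'n::finite set \<Rightarrow> (real ^ 'n ^ 'n) set" where
  "positive_diagonal V = {\<Omega>. (\<forall>u v. u \<noteq> v \<longrightarrow> \<Omega> $ u $ v = 0) \<and>
      (\<forall>v\<in>V. \<Omega> $ v $ v > 0) \<and> (\<forall>v. v \<notin> V \<longrightarrow> \<Omega> $ v $ v = 0)}"

definition loading_matrices :: "('n \<times> 'n) set \<Rightarrow> (real ^ 'n ^ 'n::finite) set" where
  "loading_matrices D = {\<Lambda>. \<forall>v h. (h, v) \<notin> D \<longrightarrow> \<Lambda> $ v $ h = 0}"

definition tau :: "real ^ 'n ^ 'n \<Rightarrow> real ^ 'n ^ 'n \<Rightarrow> real ^ 'n ^ 'n::finite" where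
  "tau \<Omega> \<Lambda> = \<Omega> + \<Lambda> ** transpose \<Lambda>"

(* Coordinates on the parameter space: Inl v is the entry omega_{vv} and Inr (h, v) is the entry
   lambda_{vh}. Coordinates Inl v with v \<notin> V and Inr (h, v) with (h, v) \<notin> D are ignored, so they
   only contribute zero columns to the Jacobian matrix below. *)

definition Omega_of :: "'n set \<Rightarrow> real ^ ('n + 'n \<times> 'n) \<Rightarrow> real ^ 'n ^ 'n::finite" where
  "Omega_of V \<theta> = (\<chi> u v. if u = v \<and> v \<in> V then \<theta> $ Inl v else 0)"

definition Lambda_of :: "('n \<times> 'n) set \<Rightarrow> real ^ ('n + 'n \<times> 'n) \<Rightarrow> real ^ 'n ^ 'n::finite" where
  "Lambda_of D \<theta> = (\<chi> v h. if (h, v) \<in> D then \<theta> $ Inr (h, v) else 0)"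

(* A symmetric matrix is given by all its entries (u, v). The entries (u, v) and (v, u) yield equal
   rows of the Jacobian matrix (and those outside V x V zero rows), so the rank is the one obtained
   from the coordinates of the (p + 1 choose 2)-dimensional space of symmetric matrices. *)

definition tau_coordinates ::
    "'n set \<Rightarrow> ('n \<times> 'n) set \<Rightarrow> real ^ ('n + 'n \<times> 'n) \<Rightarrow> real ^ ('n \<times> 'n::finite)" where
  "tau_coordinates V D \<theta> = (\<chi> e. tau (Omega_of V \<theta>) (Lambda_of D \<theta>) $ fst e $ snd e)"

definition tau_jacobian ::
    "'n set \<Rightarrow> ('n \<times> 'n) set \<Rightarrow> real ^ ('n + 'n \<times> 'n) \<Rightarrow> real ^ ('n + 'n \<times> 'n) ^ ('n \<times> 'n::finite)" where
  "tau_jacobian V D \<theta> = matrix (frechet_derivative (tau_coordinates V D) (at \<theta>))"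

definition factor_model_dim :: "'n::finite set \<Rightarrow> ('n \<times> 'n) set \<Rightarrow> nat" where
  "factor_model_dim V D =
     Max {rank (tau_jacobian V D \<theta>) | \<theta>.
            Omega_of V \<theta> \<in> positive_diagonal V \<and> Lambda_of D \<theta> \<in> loading_matrices D}"

definition two_pairs :: "'n set \<Rightarrow> 'n set set" where
  "two_pairs V = {e. e \<subseteq> V \<and> card e = 2}"

definition two_pairs_at :: "'n set \<Rightarrow> 'n set \<Rightarrow> ('n \<times> 'n) set \<Rightarrow> 'n \<Rightarrow> 'n set set" where
  "two_pairs_at V H D h = {{u, v} | u v. {u, v} \<in> two_pairs V \<and> h \<in> pa H D u \<inter> pa H D v}"

definition valid_collection ::
    "'n set \<Rightarrow> 'n set \<Rightarrow> ('n \<times> 'n) set \<Rightarrow> ('n \<Rightarrow> 'n set set) \<Rightarrow> bool" where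
  "valid_collection V H D A \<longleftrightarrow>
     (\<forall>h\<in>H. A h \<subseteq> two_pairs_at V H D h \<and> card (A h) \<le> card (ch V D h)) \<and>
     (\<forall>h\<in>H. \<forall>l\<in>H. h \<noteq> l \<longrightarrow> A h \<inter> A l = {})"

(* Labelings h_1, ..., h_m and v_1, ..., v_p are bijections from {1..m} and {1..p}. *)

definition zuta_latent_labeling ::
    "'n set \<Rightarrow> 'n set \<Rightarrow> ('n \<times> 'n) set \<Rightarrow> (nat \<Rightarrow> 'n) \<Rightarrow> bool" where
  "zuta_latent_labeling V H D hl \<longleftrightarrow>
     bij_betw hl {1..card H} H \<and>
     (\<forall>i\<in>{1..card H}. \<not> ch V D (hl i) \<subseteq> (\<Union>j\<in>{i<..card H}. ch V D (hl j)))"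

definition zuta_observed_labeling ::
    "'n set \<Rightarrow> 'n set \<Rightarrow> ('n \<times> 'n) set \<Rightarrow> (nat \<Rightarrow> 'n) \<Rightarrow> (nat \<Rightarrow> 'n) \<Rightarrow> bool" where
  "zuta_observed_labeling V H D hl vl \<longleftrightarrow>
     bij_betw vl {1..card V} V \<and>
     (\<forall>i\<in>{1..card H}. vl i \<in> ch V D (hl i) \<and> vl i \<notin> (\<Union>j\<in>{i<..card H}. ch V D (hl j)))"

definition ZUTA :: "'n set \<Rightarrow> 'n set \<Rightarrow> ('n \<times> 'n) set \<Rightarrow> bool" where
  "ZUTA V H D \<longleftrightarrow> (\<exists>hl. zuta_latent_labeling V H D hl)"

definition zuta_compliant ::
    "'n set \<Rightarrow> 'n set \<Rightarrow> ('n \<times> 'n) set \<Rightarrow> (nat \<Rightarrow> 'n) \<Rightarrow> (nat \<Rightarrow> 'n) \<Rightarrow> ('n \<Rightarrow> 'n set set) \<Rightarrow> bool" where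
  "zuta_compliant V H D hl vl A \<longleftrightarrow>
     (\<forall>i\<in>{1..card H}. \<forall>w \<in> ch V D (hl i) - {vl i}. {vl i, w} \<in> A (hl i))"

end

(* Upper bound: rank-many independent rows of the Jacobian have a system of distinct columns in which
   they are nonzero. The rows of 2-pairs matched to a column of a latent node h form a set B_h, and
   (B_h) is a valid collection; the remaining rows belong to the diagonal.

   Lower bound: let lambda be 1 on v_i and on the endpoints of the unique edge of A_{h_i} avoiding v_i
   (if there is one), and 0 elsewhere. A linear relation g among the rows of the 2-pairs in A satisfies
   sum_u g {u, v} = 0 for every v in ch(h_i), with u ranging over the nodes where lambda is 1. The three
   equations at a triangle v_i, a, b force g {a, b} = 0. By ZUTA the equations of the star edges
   {v_i, w} are then triangular in i, so g vanishes by downward induction on i. *)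

theory Submission
  imports Defs
begin

section \<open>Linear independence and coordinates in Euclidean space\<close>

text \<open>\<open>J\<close> collects the coordinates already used: adjoining their unit vectors amounts to deleting them.\<close>
lemma independent_transversal:
  fixes B :: "(real ^ 'i::finite) set"
  assumes "independent (B \<union> (\<lambda>j. axis j 1) ` J)" "B \<inter> (\<lambda>j. axis j 1) ` J = {}"
  shows "\<exists>f. inj_on f B \<and> (\<forall>b\<in>B. f b \<notin> J \<and> b $ f b \<noteq> 0)"
proof -
  have "finite B" using assms(1) independent_imp_finite by blast
  then show ?thesis using assms
  proof (induction B arbitrary: J rule: finite_induct)
    case empty
    show ?case by simp
  next
    case (insert b B)
    let ?e = "\<lambda>j::'i. axis j 1 :: real ^ 'i"
    let ?S = "B \<union> ?e ` J"
    have "b \<notin> ?S" using insert by auto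
    with insert.prems have ind: "independent ?S" and nb: "b \<notin> span ?S"
      by (auto simp: independent_insert)
    \<comment> \<open>Exchange step: \<open>b\<close> is a combination of the unit vectors at its
      nonzero coordinates. As \<open>b\<close> lies outside the span of \<open>?S\<close>, so does
      one of these unit vectors, and it can take the place of \<open>b\<close>.\<close>
    obtain i where i: "b $ i \<noteq> 0" "?e i \<notin> span ?S"
    proof (rule ccontr)
      assume "\<not> thesis"
      then have "b $ i *\<^sub>R ?e i \<in> span ?S" for i
        using that by (cases "b $ i = 0") (auto intro: span_scale span_zero)
      then have "(\<Sum>i\<in>UNIV. b $ i *\<^sub>R ?e i) \<in> span ?S" by (intro span_sum)
      moreover have "(\<Sum>i\<in>UNIV. b $ i *\<^sub>R ?e i) = b"
        using basis_expansion[of b] by (simp add: scalar_mult_eq_scaleR)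
      ultimately show False using nb by simp
    qed
    have "?e i \<notin> ?S" using i(2) by (metis span_base)
    then have iJ: "i \<notin> J" and iB: "?e i \<notin> B" by auto
    have "B \<inter> ?e ` J = {}" using insert.prems(2) by simp
    with iB have "B \<inter> ?e ` insert i J = {}" by simp
    moreover have "independent (B \<union> ?e ` insert i J)"
      using independent_insertI[OF i(2) ind] by simp
    ultimately obtain f where f: "inj_on f B" "\<forall>c\<in>B. f c \<notin> insert i J \<and> c $ f c \<noteq> 0"
      using insert.IH by blast
    have "inj_on (f(b := i)) (insert b B)"
      using f insert.hyps by (auto simp: inj_on_def)
    moreover have "\<forall>c\<in>insert b B. (f(b := i)) c \<notin> J \<and> c $ (f(b := i)) c \<noteq> 0"
      using f i iJ by auto
    ultimately show ?case by blast
  qed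
qed

text \<open>The coefficients are attached to indices, not to vectors, so a repeated vector must be
  excluded as well: \<open>r i = r j\<close> would give the relation with coefficients 1 at
  \<open>i\<close> and -1 at \<open>j\<close>.\<close>

lemma card_le_dim_if_scalars_zero:
  fixes r :: "'a \<Rightarrow> 'b::euclidean_space"
  assumes "finite I" "r ` I \<subseteq> S"
    and zero: "\<And>c i. (\<Sum>i\<in>I. c i *\<^sub>R r i) = 0 \<Longrightarrow> i \<in> I \<Longrightarrow> c i = 0"
  shows "card I \<le> dim S"
proof -
  have inj: "inj_on r I"
  proof (rule inj_onI, rule ccontr)
    fix i j assume ij: "i \<in> I" "j \<in> I" "r i = r j" "i \<noteq> j"
    let ?c = "\<lambda>k. (if k = i then 1 else 0) - (if k = j then 1 else 0) :: real"
    have "(\<Sum>k\<in>I. ?c k *\<^sub>R r k) = (\<Sum>k\<in>I. (if k = i then r k else 0) - (if k = j then r k else 0))"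
      by (rule sum.cong) (auto simp: algebra_simps)
    also have "\<dots> = r i - r j"
      using ij assms(1) by (simp add: sum_subtractf)
    finally have "?c i = 0" using zero[of ?c i] ij by simp
    then show False using ij by simp
  qed
  have "independent (r ` I)"
    unfolding independent_explicit
  proof (intro conjI allI impI ballI)
    fix c v assume "(\<Sum>v\<in>r ` I. c v *\<^sub>R v) = 0" "v \<in> r ` I"
    then show "c v = 0" using zero[of "c \<circ> r"] inj by (auto simp: sum.reindex)
  qed (use assms in simp)
  then have "card (r ` I) \<le> dim S" using assms(2) independent_card_le_dim by blast
  then show ?thesis using inj by (simp add: card_image)
qed

section \<open>The rows of the Jacobian matrix\<close>

text \<open>The gradient of the entry of \<open>tau\<close> at (u, w) with
  \<open>s = {u, w}\<close>. Indexing by a set merges the entries (u, w) and (w, u), and singletons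
  stand for the diagonal. The sum over \<open>u\<close> has at most one nonzero term: it selects the
  endpoint of \<open>s\<close> other than \<open>v\<close>, or \<open>v\<close> itself if
  \<open>s = {v}\<close>. The factor 2 comes from differentiating a square.\<close>

definition pair_row ::
    "'n set \<Rightarrow> ('n \<times> 'n) set \<Rightarrow> real ^ ('n + 'n \<times> 'n) \<Rightarrow> 'n set \<Rightarrow> real ^ ('n + 'n \<times> 'n::finite)" where
  "pair_row V D \<theta> s = (\<chi> c. case c of
     Inl v \<Rightarrow> if s = {v} \<and> v \<in> V then 1 else 0
   | Inr (h, v) \<Rightarrow> if (h, v) \<in> D
       then (if s = {v} then 2 else 1) * (\<Sum>u\<in>UNIV. if s = {u, v} \<and> (h, u) \<in> D then \<theta> $ Inr (h, u) else 0)
       else 0)"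

lemma pair_row_Inl: "pair_row V D \<theta> s $ Inl v = (if s = {v} \<and> v \<in> V then 1 else 0)"
  by (simp add: pair_row_def)

lemma pair_row_Inr: "pair_row V D \<theta> s $ Inr (h, v) = (if (h, v) \<in> D
   then (if s = {v} then 2 else 1) * (\<Sum>u\<in>UNIV. if s = {u, v} \<and> (h, u) \<in> D then \<theta> $ Inr (h, u) else 0)
   else 0)"
  by (simp add: pair_row_def)

lemma tau_coordinates_has_derivative:
  fixes \<theta> :: "real ^ ('n + 'n \<times> 'n::finite)"
  shows "(tau_coordinates V D has_derivative (\<lambda>x. \<chi> e.
      Omega_of V x $ fst e $ snd e +
      (\<Sum>h\<in>UNIV. Lambda_of D \<theta> $ fst e $ h * Lambda_of D x $ snd e $ h
                + Lambda_of D x $ fst e $ h * Lambda_of D \<theta> $ snd e $ h))) (at \<theta>)"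
proof -
  have Om: "((\<lambda>\<theta>. Omega_of V \<theta> $ u $ v) has_derivative (\<lambda>x. Omega_of V x $ u $ v)) (at \<theta>)" for u v
    by (cases "u = v \<and> v \<in> V")
      (auto simp: Omega_of_def intro!: bounded_linear_imp_has_derivative bounded_linear_vec_nth)
  have La: "((\<lambda>\<theta>. Lambda_of D \<theta> $ v $ h) has_derivative (\<lambda>x. Lambda_of D x $ v $ h)) (at \<theta>)" for v h
    by (cases "(h, v) \<in> D")
      (auto simp: Lambda_of_def intro!: bounded_linear_imp_has_derivative bounded_linear_vec_nth)
  have "((\<lambda>\<theta>. tau_coordinates V D \<theta> $ e) has_derivative (\<lambda>x. 
      Omega_of V x $ fst e $ snd e +
      (\<Sum>h\<in>UNIV. Lambda_of D \<theta> $ fst e $ h * Lambda_of D x $ snd e $ h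
                + Lambda_of D x $ fst e $ h * Lambda_of D \<theta> $ snd e $ h))) (at \<theta>)" for e
    by (simp add: tau_coordinates_def tau_def matrix_matrix_mult_def transpose_def)
      (intro derivative_intros Om La)
  then show ?thesis
    by (subst has_derivative_componentwise_within) (auto simp: Basis_vec_def inner_axis)
qed

text \<open>In the column of the loading at (v, h), the product rule leaves the loading of u if w =
  v, plus the loading of w if u = v.\<close>

lemma row_tau_jacobian:
  fixes \<theta> :: "real ^ ('n + 'n \<times> 'n::finite)"
  shows "row (u, w) (tau_jacobian V D \<theta>) = pair_row V D \<theta> {u, w}"
proof -
  have fd: "frechet_derivative (tau_coordinates V D) (at \<theta>) = (\<lambda>x. \<chi> e.
      Omega_of V x $ fst e $ snd e +
      (\<Sum>h\<in>UNIV. Lambda_of D \<theta> $ fst e $ h * Lambda_of D x $ snd e $ h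
                + Lambda_of D x $ fst e $ h * Lambda_of D \<theta> $ snd e $ h))"
    using frechet_derivative_at[OF tau_coordinates_has_derivative[of V D \<theta>]] by simp
  have Om: "Omega_of V (axis (Inl v) 1) $ x $ y = (if x = y \<and> y = v \<and> v \<in> V then 1 else 0)"
      "Omega_of V (axis (Inr p) 1) $ x $ y = 0" for v x y :: 'n and p
    by (auto simp: Omega_of_def axis_def)
  have La: "Lambda_of D (axis (Inl v) 1) $ x $ k = 0"
      "Lambda_of D (axis (Inr (h, v)) 1) $ x $ k = (if k = h \<and> x = v \<and> (h, v) \<in> D then 1 else 0)"
      "Lambda_of D \<theta> $ x $ k = (if (k, x) \<in> D then \<theta> $ Inr (k, x) else 0)"
    for h v x k :: 'n
    by (auto simp: Lambda_of_def axis_def)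
  have entry: "row (u, w) (tau_jacobian V D \<theta>) $ j = Omega_of V (axis j 1) $ u $ w +
      (\<Sum>k\<in>UNIV. Lambda_of D \<theta> $ u $ k * Lambda_of D (axis j 1) $ w $ k
                + Lambda_of D (axis j 1) $ u $ k * Lambda_of D \<theta> $ w $ k)" for j
    by (simp add: row_def tau_jacobian_def matrix_def fd)
  have "row (u, w) (tau_jacobian V D \<theta>) $ Inl v = pair_row V D \<theta> {u, w} $ Inl v" for v
    by (auto simp: entry pair_row_Inl Om La(1))
  moreover have "row (u, w) (tau_jacobian V D \<theta>) $ Inr (h, v) = pair_row V D \<theta> {u, w} $ Inr (h, v)" for h v
  proof -
    have "row (u, w) (tau_jacobian V D \<theta>) $ Inr (h, v) =
      (\<Sum>k\<in>UNIV. if k = h then (if (h, v) \<in> D then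
         (if w = v \<and> (h, u) \<in> D then \<theta> $ Inr (h, u) else 0) +
         (if u = v \<and> (h, w) \<in> D then \<theta> $ Inr (h, w) else 0) else 0) else 0)"
      unfolding entry Om add_0 by (rule sum.cong) (auto simp: La)
    also have "\<dots> = (if (h, v) \<in> D then
         (if w = v \<and> (h, u) \<in> D then \<theta> $ Inr (h, u) else 0) +
         (if u = v \<and> (h, w) \<in> D then \<theta> $ Inr (h, w) else 0) else 0)" by simp
    also have "\<dots> = pair_row V D \<theta> {u, w} $ Inr (h, v)"
    \<comment> \<open>If w = v, the endpoint selected by \<open>pair_row\<close> is u. This includes
      u = v, where the two terms of the product rule coincide and give the factor 2.\<close>
    proof (cases "w = v")
      case True
      have "(\<Sum>x\<in>UNIV. if {u, v} = {x, v} \<and> (h, x) \<in> D then \<theta> $ Inr (h, x) else 0)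
        = (\<Sum>x\<in>UNIV. if x = u then (if (h, u) \<in> D then \<theta> $ Inr (h, u) else 0) else 0)"
        by (rule sum.cong) (auto simp: doubleton_eq_iff)
      then show ?thesis using True by (auto simp: pair_row_Inr)
    next
      case False
      have "(\<Sum>x\<in>UNIV. if {u, w} = {x, v} \<and> (h, x) \<in> D then \<theta> $ Inr (h, x) else 0)
        = (\<Sum>x\<in>UNIV. if x = w then (if u = v \<and> (h, w) \<in> D then \<theta> $ Inr (h, w) else 0) else 0)"
        using False by (intro sum.cong) (auto simp: doubleton_eq_iff)
      then show ?thesis using False by (auto simp: pair_row_Inr)
    qed
    finally show ?thesis .
  qed
  ultimately show ?thesis by (subst vec_eq_iff) (metis sum.exhaust surj_pair)
qed

lemma rows_tau_jacobian: "rows (tau_jacobian V D \<theta>) = {pair_row V D \<theta> {u, w} | u w. True}"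
  by (simp add: rows_def row_tau_jacobian split_paired_Ex)

section \<open>The upper bound on the rank by a valid collection\<close>

lemma two_pairs_at_iff:
  assumes "factor_analysis_graph V H D"
  shows "e \<in> two_pairs_at V H D h \<longleftrightarrow>
    (\<exists>u v. e = {u, v} \<and> u \<noteq> v \<and> u \<in> ch V D h \<and> v \<in> ch V D h)"
proof -
  have "{u, v} \<in> two_pairs V \<and> h \<in> pa H D u \<inter> pa H D v \<longleftrightarrow>
      u \<noteq> v \<and> u \<in> ch V D h \<and> v \<in> ch V D h" for u v
    using assms unfolding factor_analysis_graph_def two_pairs_def pa_def ch_def
    by (cases "u = v") auto
  then show ?thesis unfolding two_pairs_at_def by blast
qed

lemma rank_tau_jacobian_le:
  fixes V H :: "'n::finite set"
  assumes graph: "factor_analysis_graph V H D"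
  obtains B where "valid_collection V H D B"
    "rank (tau_jacobian V D \<theta>) \<le> card V + (\<Sum>h\<in>H. card (B h))"
proof -
  have D: "D \<subseteq> H \<times> V" using graph by (simp add: factor_analysis_graph_def)
  obtain R where R: "R \<subseteq> rows (tau_jacobian V D \<theta>)" "independent R"
      "card R = rank (tau_jacobian V D \<theta>)"
    unfolding row_rank_def by (rule basis_exists)
  have fin: "finite R" using R(2) independent_imp_finite by blast
  obtain f where f: "inj_on f R" "\<And>b. b \<in> R \<Longrightarrow> b $ f b \<noteq> 0"
    using independent_transversal[of R "{}"] R(2) by auto
  have "\<forall>b\<in>R. \<exists>s. b = pair_row V D \<theta> s \<and> (\<exists>u w. s = {u, w})"
    using R(1) by (fastforce simp: rows_tau_jacobian)
  \<comment> \<open>Different sets may give the same row; \<open>e\<close> picks one of them for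
    each basis row. It is injective because a row is recovered from its set.\<close>
  then obtain e where e: "\<And>b. b \<in> R \<Longrightarrow> b = pair_row V D \<theta> (e b)"
    by metis
  have inj_e: "inj_on e R" by (rule inj_onI) (metis e)
  \<comment> \<open>A column restricts the rows matched to it: the column of a variance is nonzero
    only in the row of its singleton, the column of a loading of h only in rows whose endpoints are
    all children of h.\<close>
  have col_Inl: "e b = {v} \<and> v \<in> V" if "b \<in> R" "f b = Inl v" for b v
    using f(2)[OF that(1)] e[OF that(1)] that(2) by (metis pair_row_Inl)
  have col_Inr: "(h, v) \<in> D \<and> (\<exists>u. e b = {u, v} \<and> (h, u) \<in> D)"
    if "b \<in> R" "f b = Inr (h, v)" for b h v
  proof -
    have "pair_row V D \<theta> (e b) $ Inr (h, v) \<noteq> 0" using f(2) e that by metis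
    then have hv: "(h, v) \<in> D"
      and nz: "(\<Sum>u\<in>UNIV. if e b = {u, v} \<and> (h, u) \<in> D then \<theta> $ Inr (h, u) else 0) \<noteq> 0"
      unfolding pair_row_Inr by (metis, metis mult_zero_right)
    have "\<exists>u. e b = {u, v} \<and> (h, u) \<in> D"
    proof (rule ccontr)
      assume "\<not> ?thesis"
      then have no: "\<not> (e b = {u, v} \<and> (h, u) \<in> D)" for u by blast
      show False using nz unfolding if_not_P[OF no] by simp
    qed
    then show ?thesis using hv by blast
  qed
  \<comment> \<open>Diagonal rows are separated by their set, not by their column, since they may be
    matched to loading columns too. The other rows all have loading columns, and \<open>S h\<close>
    gathers those matched to the latent node \<open>h\<close>.\<close>
  define R1 where "R1 = {b \<in> R. \<exists>v. e b = {v}}"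
  define S where "S h = {b \<in> R - R1. \<exists>v. f b = Inr (h, v)}" for h
  have S: "\<exists>u. e b = {u, v} \<and> u \<noteq> v \<and> u \<in> ch V D h \<and> v \<in> ch V D h"
    if "b \<in> S h" "f b = Inr (h, v)" for b h v
    using col_Inr[of b h v] that D by (auto simp: S_def R1_def ch_def)
  have "e ` R1 \<subseteq> (\<lambda>v. {v}) ` V"
  proof clarify
    fix b assume b: "b \<in> R1"
    then obtain v where v: "e b = {v}" "b \<in> R" by (auto simp: R1_def)
    have "v \<in> V"
    proof (cases "f b")
      case (Inl x)
      then show ?thesis using col_Inl[of b x] v by auto
    next
      case (Inr p)
      then show ?thesis using col_Inr[of b "fst p" "snd p"] v D by auto
    qed
    then show "e b \<in> (\<lambda>v. {v}) ` V" using v by simp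
  qed
  then have "card (e ` R1) \<le> card V" by (rule surj_card_le[rotated]) simp
  then have R1: "card R1 \<le> card V"
    using inj_e by (subst (asm) card_image) (auto simp: R1_def inj_on_def)
  have "R - R1 \<subseteq> (\<Union>h\<in>H. S h)"
  proof
    fix b assume b: "b \<in> R - R1"
    show "b \<in> (\<Union>h\<in>H. S h)"
    proof (cases "f b")
      case (Inl x)
      then show ?thesis using col_Inl[of b x] b by (auto simp: R1_def)
    next
      case (Inr p)
      then show ?thesis using col_Inr[of b "fst p" "snd p"] b D by (auto simp: S_def)
    qed
  qed
  then have "card (R - R1) \<le> card (\<Union>h\<in>H. S h)"
    by (intro card_mono) (use fin in \<open>auto simp: S_def\<close>)
  also have "\<dots> \<le> (\<Sum>h\<in>H. card (S h))" by (intro card_UN_le) simp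
  also have "\<dots> = (\<Sum>h\<in>H. card (e ` S h))"
    using inj_e by (intro sum.cong refl card_image[symmetric]) (auto simp: S_def inj_on_def)
  finally have "card (R - R1) \<le> (\<Sum>h\<in>H. card (e ` S h))" .
  moreover have "card R = card R1 + card (R - R1)"
    by (metis (no_types, lifting) R1_def card_Diff_subset card_mono fin finite_subset
        le_add_diff_inverse mem_Collect_eq subsetI)
  ultimately have "rank (tau_jacobian V D \<theta>) \<le> card V + (\<Sum>h\<in>H. card (e ` S h))"
    using R1 R(3) by linarith
  moreover have "valid_collection V H D (\<lambda>h. e ` S h)"
    unfolding valid_collection_def
  proof (intro conjI ballI impI)
    fix h assume "h \<in> H"
    show "e ` S h \<subseteq> two_pairs_at V H D h"
    proof
      fix s assume "s \<in> e ` S h"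
      then obtain b v where "s = e b" "b \<in> S h" "f b = Inr (h, v)" by (auto simp: S_def)
      then show "s \<in> two_pairs_at V H D h"
        unfolding two_pairs_at_iff[OF graph] using S by blast
    qed
    have "card (e ` S h) \<le> card (S h)" by (rule card_image_le) (use fin in \<open>simp add: S_def\<close>)
    \<comment> \<open>Distinct rows in \<open>S h\<close> have distinct columns, and each such
      column belongs to a child of \<open>h\<close>; this is the cardinality condition of
      validity.\<close>
    also have "\<dots> \<le> card ((\<lambda>v. Inr (h, v) :: 'n + 'n \<times> 'n) ` ch V D h)"
    proof (rule card_inj_on_le)
      show "inj_on f (S h)" using f(1) by (auto simp: S_def inj_on_def)
      show "f ` S h \<subseteq> (\<lambda>v. Inr (h, v)) ` ch V D h"
        using S by (fastforce simp: S_def)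
    qed simp
    also have "\<dots> \<le> card (ch V D h)" by (rule card_image_le) simp
    finally show "card (e ` S h) \<le> card (ch V D h)" .
  next
    fix h l :: 'n assume "h \<noteq> l"
    then have "S h \<inter> S l = {}" by (auto simp: S_def)
    then show "e ` S h \<inter> e ` S l = {}"
      using inj_on_image_Int[OF inj_e, of "S h" "S l"] by (auto simp: S_def)
  qed
  ultimately show thesis using that by blast
qed

section \<open>The equations attached to a ZUTA-compliant collection\<close>

text \<open>The nodes where a column of the chosen loading matrix equals 1: \<open>c\<close> is the
  centre of the star and \<open>F\<close> the pairs assigned to the latent node. For a compliant
  valid collection at most one pair of \<open>F\<close> avoids \<open>c\<close>, so the set has one
  or three elements.\<close>

definition zuta_support :: "'n \<Rightarrow> 'n set set \<Rightarrow> 'n set" where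
  "zuta_support c F = insert c (\<Union>{e \<in> F. c \<notin> e})"

locale zuta_compliant_valid_collection =
  fixes V H :: "'n::finite set"
    and D :: "('n \<times> 'n) set"
    and hl vl :: "nat \<Rightarrow> 'n"
    and A :: "'n \<Rightarrow> 'n set set"
  assumes graph: "factor_analysis_graph V H D"
    and bij_hl: "bij_betw hl {1..card H} H"
    and observed: "zuta_observed_labeling V H D hl vl"
    and valid: "valid_collection V H D A"
    and compliant: "zuta_compliant V H D hl vl A"
begin

abbreviation children :: "nat \<Rightarrow> 'n set" where
  "children i \<equiv> ch V D (hl i)"

abbreviation support :: "nat \<Rightarrow> 'n set" where
  "support i \<equiv> zuta_support (vl i) (A (hl i))"

lemma hl_in: "i \<in> {1..card H} \<Longrightarrow> hl i \<in> H"
  using bij_hl by (auto simp: bij_betw_def)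

lemma vl_in_children: "i \<in> {1..card H} \<Longrightarrow> vl i \<in> children i"
  using observed by (simp add: zuta_observed_labeling_def)

lemma vl_notin_children: "i \<in> {1..card H} \<Longrightarrow> j \<in> {1..card H} \<Longrightarrow> i < j \<Longrightarrow> vl i \<notin> children j"
  using observed by (auto simp: zuta_observed_labeling_def)

lemma edge_cases:
  assumes "e \<in> A h" "h \<in> H"
  obtains u v where "e = {u, v}" "u \<noteq> v" "u \<in> ch V D h" "v \<in> ch V D h"
proof -
  have "e \<in> two_pairs_at V H D h" using assms valid by (auto simp: valid_collection_def)
  then show thesis using that by (auto simp: two_pairs_at_iff[OF graph])
qed

lemma edge_index:
  assumes "e \<in> (\<Union>h\<in>H. A h)"
  obtains i where "i \<in> {1..card H}" "e \<in> A (hl i)"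
proof -
  obtain h where "h \<in> H" "e \<in> A h" using assms by blast
  moreover have "hl ` {1..card H} = H" using bij_hl by (simp add: bij_betw_def)
  ultimately show thesis using that by (metis imageE)
qed

lemma star_edge_cases:
  assumes "e \<in> A h" "h \<in> H" "c \<in> e"
  obtains w where "e = {c, w}" "w \<in> ch V D h - {c}"
proof -
  obtain u v where uv: "e = {u, v}" "u \<noteq> v" "u \<in> ch V D h" "v \<in> ch V D h"
    using assms edge_cases by metis
  show thesis
  proof (cases "c = u")
    case True
    then show ?thesis using that[of v] uv by auto
  next
    case False
    then show ?thesis using that[of u] uv assms(3) by (auto simp: insert_commute)
  qed
qed

lemma singleton_notin: "h \<in> H \<Longrightarrow> {v} \<notin> A h"
  by (auto elim!: edge_cases simp: singleton_insert_inj_eq')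

lemma support_subset_children:
  assumes "i \<in> {1..card H}"
  shows "support i \<subseteq> children i"
proof -
  have "e \<subseteq> children i" if "e \<in> A (hl i)" for e
    using edge_cases[OF that hl_in[OF assms]] by blast
  then show ?thesis using vl_in_children[OF assms] by (auto simp: zuta_support_def)
qed

text \<open>The star at \<open>vl i\<close> already has \<open>card (children i) - 1\<close> edges.\<close>
lemma extra_edge_unique:
  assumes i: "i \<in> {1..card H}" and e: "e \<in> A (hl i)" "vl i \<notin> e"
  shows "{e \<in> A (hl i). vl i \<notin> e} = {e}"
proof -
  let ?F = "{e \<in> A (hl i). vl i \<notin> e}" and ?star = "(\<lambda>w. {vl i, w}) ` (children i - {vl i})"
  have "?star \<subseteq> A (hl i)" using compliant i by (auto simp: zuta_compliant_def)
  then have "card (?star \<union> ?F) \<le> card (A (hl i))" by (intro card_mono) auto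
  moreover have "card (?star \<union> ?F) = card ?star + card ?F" by (rule card_Un_disjoint) auto
  moreover have "card ?star = card (children i) - 1"
    using vl_in_children[OF i] by (subst card_image) (auto simp: inj_on_def doubleton_eq_iff)
  moreover have "card (A (hl i)) \<le> card (children i)"
    using valid hl_in[OF i] by (simp add: valid_collection_def)
  moreover have "card (children i) > 0" using vl_in_children[OF i] by (auto simp: card_gt_0_iff)
  ultimately have "card ?F \<le> Suc 0" by linarith
  then show ?thesis using e by (auto simp: card_le_Suc0_iff_eq)
qed

text \<open>Here \<open>g\<close> plays the role of the coefficients of a linear relation among the
  rows of the collection, and \<open>g_sum\<close> is that relation read in one loading column.
  Extending by zero lets the sums run over the whole support, including \<open>u = v\<close> and
  pairs outside the collection.\<close>

context
  fixes g :: "'n set \<Rightarrow> real"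
  assumes g_outside: "\<And>s. s \<notin> (\<Union>h\<in>H. A h) \<Longrightarrow> g s = 0"
    and g_sum: "\<And>i v. i \<in> {1..card H} \<Longrightarrow> v \<in> children i \<Longrightarrow> (\<Sum>u\<in>support i. g {u, v}) = 0"
begin

text \<open>The three unknowns sit on the edges of a triangle and each equation adds the two edges
  at one corner. Adding the equations at \<open>a\<close> and \<open>b\<close> and subtracting the
  one at \<open>vl i\<close> leaves twice \<open>g {a, b}\<close>.\<close>

lemma extra_edge_zero:
  assumes i: "i \<in> {1..card H}" and e: "e \<in> A (hl i)" "vl i \<notin> e"
  shows "g e = 0"
proof -
  obtain a b where ab: "e = {a, b}" "a \<noteq> b" "a \<in> children i" "b \<in> children i"
    using edge_cases[OF e(1) hl_in[OF i]] .
  have supp: "support i = {vl i, a, b}"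
    using extra_edge_unique[OF assms] ab(1) by (simp add: zuta_support_def)
  have diag: "g {v} = 0" for v using g_outside[of "{v}"] singleton_notin by auto
  have "g {a, vl i} + g {b, vl i} = 0" "g {vl i, a} + g {b, a} = 0" "g {vl i, b} + g {a, b} = 0"
    using g_sum[OF i vl_in_children[OF i]] g_sum[OF i ab(3)] g_sum[OF i ab(4)] ab e(2)
    by (auto simp: supp diag)
  then show ?thesis using ab(1) by (simp add: insert_commute)
qed

text \<open>In the equation at \<open>w\<close>, every term besides \<open>g {vl i, w}\<close> is
  outside the collection, or an extra edge, or a star edge of a later latent node, so induction on
  \<open>card H - i\<close> applies.\<close>

lemma star_edge_zero:
  assumes "i \<in> {1..card H}" "w \<in> children i - {vl i}"
  shows "g {vl i, w} = 0"
  using assms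
proof (induction "card H - i" arbitrary: i w rule: less_induct)
  case less
  note i = less.prems(1)
  have other: "g {u, w} = 0" if u: "u \<in> support i - {vl i}" for u
  proof (cases "{u, w} \<in> (\<Union>h\<in>H. A h)")
    case False
    then show ?thesis by (rule g_outside)
  next
    case True
    then obtain k where k: "k \<in> {1..card H}" "{u, w} \<in> A (hl k)" by (rule edge_index)
    show ?thesis
    proof (cases "vl k \<in> {u, w}")
      case False
      then show ?thesis using extra_edge_zero k by blast
    next
      case True
      have "{u, w} \<subseteq> children i - {vl i}"
        using u less.prems support_subset_children by auto
      \<comment> \<open>Both endpoints are children of \<open>hl i\<close> other than
        \<open>vl i\<close>, so \<open>k = i\<close> is excluded; \<open>k < i\<close> is excluded
        because \<open>vl k\<close> is not a child of any later latent node.\<close>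
      then have "i < k"
        using True vl_notin_children[OF k(1) i] by (cases k i rule: linorder_cases) auto
      moreover obtain x where "{u, w} = {vl k, x}" "x \<in> children k - {vl k}"
        using star_edge_cases[OF k(2) hl_in[OF k(1)] True] .
      ultimately show ?thesis using less.hyps[of k x] k(1) by auto
    qed
  qed
  have "0 = (\<Sum>u\<in>support i. g {u, w})" using g_sum less.prems by simp
  also have "\<dots> = g {vl i, w} + (\<Sum>u\<in>support i - {vl i}. g {u, w})"
    by (rule sum.remove) (auto simp: zuta_support_def)
  finally show ?case using other by simp
qed

lemma all_zero: "g s = 0"
proof (cases "s \<in> (\<Union>h\<in>H. A h)")
  case False
  then show ?thesis by (rule g_outside)
next
  case True
  then obtain i where i: "i \<in> {1..card H}" "s \<in> A (hl i)" by (rule edge_index)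
  show ?thesis
  proof (cases "vl i \<in> s")
    case True
    then show ?thesis using star_edge_cases[OF i(2) hl_in[OF i(1)]] star_edge_zero[OF i(1)] by metis
  qed (use i extra_edge_zero in blast)
qed

end

section \<open>The lower bound at a loading matrix with entries 0 and 1\<close>

text \<open>The value 1 on the diagonal is only a choice of a positive number: no entry of
  \<open>pair_row\<close> depends on the variances.\<close>

definition witness :: "real ^ ('n + 'n \<times> 'n)" where
  "witness = (\<chi> c. case c of
     Inl v \<Rightarrow> 1
   | Inr (h, v) \<Rightarrow> if \<exists>i\<in>{1..card H}. h = hl i \<and> v \<in> support i then 1 else 0)"

lemma witness_Inr:
  assumes "i \<in> {1..card H}"
  shows "witness $ Inr (hl i, v) = (if v \<in> support i then 1 else 0)"
proof -
  have "j = i" if "j \<in> {1..card H}" "hl i = hl j" for j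
    using inj_onD[OF bij_betw_imp_inj_on[OF bij_hl] that(2) assms that(1)] by simp
  then have "(\<exists>j\<in>{1..card H}. hl i = hl j \<and> v \<in> support j) \<longleftrightarrow> v \<in> support i"
    using assms by blast
  then show ?thesis unfolding witness_def by simp
qed

lemma witness_admissible:
  "Omega_of V witness \<in> positive_diagonal V" "Lambda_of D witness \<in> loading_matrices D"
  by (auto simp: positive_diagonal_def loading_matrices_def Omega_of_def Lambda_of_def witness_def)

text \<open>The rows of the singletons of \<open>V\<close> and of the pairs in the collection are
  independent at \<open>witness\<close>: the variance columns annihilate the diagonal coefficients,
  and the loading columns then give the equations \<open>g_sum\<close>.\<close>

lemma rank_witness_ge:
  "card V + (\<Sum>h\<in>H. card (A h)) \<le> rank (tau_jacobian V D witness)"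
proof -
  define E where "E = (\<Union>h\<in>H. A h)"
  define I where "I = (\<lambda>v. {v}) ` V \<union> E"
  have single: "{v} \<notin> E" for v using singleton_notin by (auto simp: E_def)
  have "card E = (\<Sum>h\<in>H. card (A h))"
    unfolding E_def using valid by (intro card_UN_disjoint) (auto simp: valid_collection_def)
  moreover have "card I = card V + card E"
    unfolding I_def using single by (subst card_Un_disjoint) (auto simp: card_image)
  moreover have "card I \<le> dim (rows (tau_jacobian V D witness))"
  proof (rule card_le_dim_if_scalars_zero)
    show "finite I" by simp
    have "\<exists>u w. s = {u, w}" if "s \<in> I" for s
      using that unfolding I_def E_def by (metis UN_E UnE edge_cases imageE insert_absorb2)
    then show "pair_row V D witness ` I \<subseteq> rows (tau_jacobian V D witness)"
      by (fastforce simp: rows_tau_jacobian)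
  next
    fix c s assume *: "(\<Sum>s\<in>I. c s *\<^sub>R pair_row V D witness s) = 0" and s: "s \<in> I"
    have comp: "(\<Sum>s\<in>I. c s * pair_row V D witness s $ j) = 0" for j
      using arg_cong[OF *, of "\<lambda>x. x $ j"] by simp
    have diag: "c {v} = 0" if "v \<in> V" for v
      using comp[of "Inl v"] that by (simp add: pair_row_Inl I_def if_distrib sum.If_cases cong: if_cong)
    define g where "g s = (if s \<in> E then c s else 0)" for s
    have "g s = 0" for s
    proof (rule all_zero)
      fix i v assume i: "i \<in> {1..card H}" and v: "v \<in> children i"
      have hv: "(hl i, v) \<in> D" using v by (simp add: ch_def)
      \<comment> \<open>Writing each entry as a sum over the possible other endpoints
        \<open>u\<close> allows the order of summation to be exchanged. For a singleton
        \<open>s\<close> both sides vanish, by \<open>diag\<close> on the left and by the definition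
        of \<open>g\<close> on the right.\<close>
      have "c s * pair_row V D witness s $ Inr (hl i, v) =
          (\<Sum>u\<in>UNIV. if s = {u, v} then if u \<in> support i then g {u, v} else 0 else 0)" if "s \<in> I" for s
      proof (cases "s \<in> E")
        case True
        have "c s * (if s = {u, v} \<and> (hl i, u) \<in> D then witness $ Inr (hl i, u) else 0) =
            (if s = {u, v} then if u \<in> support i then g {u, v} else 0 else 0)" for u
          using True support_subset_children[OF i]
          by (cases "s = {u, v}") (auto simp: witness_Inr[OF i] g_def ch_def)
        moreover have "s \<noteq> {v}" using True single by auto
        ultimately show ?thesis using hv by (simp add: pair_row_Inr sum_distrib_left)
      next
        case False
        then have "(if s = {u, v} then if u \<in> support i then g {u, v} else 0 else 0) = 0" for u
          by (cases "s = {u, v}") (simp_all add: g_def)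
        moreover have "c s = 0" using False that diag by (auto simp: I_def)
        ultimately show ?thesis by simp
      qed
      then have "0 = (\<Sum>s\<in>I. \<Sum>u\<in>UNIV. if s = {u, v} then if u \<in> support i then g {u, v} else 0 else 0)"
        using comp[of "Inr (hl i, v)"] by simp
      also have "\<dots> = (\<Sum>u\<in>UNIV. \<Sum>s\<in>I. if s = {u, v} then if u \<in> support i then g {u, v} else 0 else 0)"
        by (rule sum.swap)
      also have "\<dots> = (\<Sum>u\<in>UNIV. if u \<in> support i then g {u, v} else 0)"
        \<comment> \<open>A set \<open>{u, v}\<close> outside \<open>I\<close> is also outside
          \<open>E\<close>, so \<open>g\<close> is zero there and no term is lost.\<close>
        by (rule sum.cong) (auto simp: g_def I_def)
      finally show "(\<Sum>u\<in>support i. g {u, v}) = 0" by (simp add: sum.If_cases)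
    qed (simp add: g_def E_def)
    then have "s \<in> E \<Longrightarrow> c s = 0" by (metis g_def)
    then show "c s = 0" using s diag by (auto simp: I_def)
  qed
  ultimately show ?thesis by (simp add: row_rank_def)
qed

end

section \<open>Combination of the two bounds\<close>

theorem corollary2p14:
  fixes V H :: "'n::finite set"
    and D :: "('n \<times> 'n) set"
    and hl vl :: "nat \<Rightarrow> 'n"
    and A :: "'n \<Rightarrow> 'n set set"
  assumes "factor_analysis_graph V H D"
    and "ZUTA V H D"
    and "zuta_latent_labeling V H D hl"
    and "zuta_observed_labeling V H D hl vl"
    and "valid_collection V H D A"
    and "zuta_compliant V H D hl vl A"
    and "\<And>B. valid_collection V H D B \<Longrightarrow> (\<Sum>h\<in>H. card (B h)) \<le> (\<Sum>h\<in>H. card (A h))"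
  shows "factor_model_dim V D = card V + (\<Sum>h\<in>H. card (A h))"
proof -
  interpret zuta_compliant_valid_collection V H D hl vl A
    using assms by unfold_locales (auto simp: zuta_latent_labeling_def)
  let ?d = "card V + (\<Sum>h\<in>H. card (A h))"
  have le: "rank (tau_jacobian V D \<theta>) \<le> ?d" for \<theta>
  proof -
    obtain B where "valid_collection V H D B"
        "rank (tau_jacobian V D \<theta>) \<le> card V + (\<Sum>h\<in>H. card (B h))"
      using rank_tau_jacobian_le[OF assms(1)] .
    then show ?thesis using assms(7)[of B] by linarith
  qed
  have "rank (tau_jacobian V D witness) = ?d"
    using le rank_witness_ge by (rule antisym)
  \<comment> \<open>\<open>Max\<close> needs a finite set; the parameters are infinitely many, but
    the ranks are bounded uniformly.\<close>
  moreover have "finite {rank (tau_jacobian V D \<theta>) | \<theta>.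
      Omega_of V \<theta> \<in> positive_diagonal V \<and> Lambda_of D \<theta> \<in> loading_matrices D}"
    by (rule finite_subset[of _ "{..?d}"]) (use le in auto)
  ultimately show ?thesis
    unfolding factor_model_dim_def using le witness_admissible
    by (intro Max_eqI) (blast, blast, force)
qed

end
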